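(* Let $d,N\ge1$, let $A=\sum_{x=0}^{d-1}a_x|x\rangle\langle x|$ be an observable (Hermitian operator) on $\mathbb{C}^d$ with orthonormal eigenbasis $\{|x\rangle\}_{x=0}^{d-1}$, let $t_0\le t_1\le\cdots\le t_N$, and let the dynamics be unitary. Let $p^{\cal K}(m_1,\dots,m_N)$ be the distribution of observed trajectories obtained from measurements at times $t_1,\dots,t_N$ with the Kraus operators $\{K_m\}$ specified in the context. Then all correlation functions $$C(t_{\mu_1},\dots,t_{\mu_j},t_{\mu_{j+1}},\dots,t_{\mu_k})$$ with $\mu_1\le\mu_2\le\cdots\le\mu_{j-1}\le\mu_j$ and $\mu_j\ge\mu_{j+1}\ge\cdots\ge\mu_{k-1}\ge\mu_k$ for some $\mu_j\le N$ (indices $\mu_i\in\{1,\dots,N\}$) can be simultaneously deduced from the distribution of observed trajectories $p^{\cal K}(m_1,\dots,m_N)$.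
   Context: The dynamics is given by unitaries $U_{t_i\to t_j}$ on $\mathbb{C}^d$ ($0\le i\le j\le N$) with $U_{t_i\to t_i}=\mathbb{1}$ and $U_{t_i\to t_l}=U_{t_j\to t_l}U_{t_i\to t_j}$ for $i\le j\le l$. The initial state is a density matrix $\rho_{t_0}$, and $\rho_{t_1}=U_{t_0\to t_1}\rho_{t_0}U_{t_0\to t_1}^\dagger$. Heisenberg-picture observables are $A(t_i)=U_{t_0\to t_i}^\dagger A\,U_{t_0\to t_i}$, and correlation functions are $C(s_1,\dots,s_k)=\mathrm{Tr}[\rho_{t_0}A(s_1)\cdots A(s_k)]$ for times $s_1,\dots,s_k$ among the $t_i$. Kraus operators: let $\{|\phi_m\rangle\}$ be a finite family of unit vectors in $\mathbb{C}^d$ such that $\sum_m|\phi_m\rangle\langle\phi_m|=\alpha\mathbb{1}$ for some $\alpha>0$ and the projectors $|\phi_m\rangle\langle\phi_m|$ are informationally complete, i.e. span over $\mathbb{C}$ the space of all operators on $\mathbb{C}^d$. Set $K_m=\sum_{x=0}^{d-1}\frac{\langle\phi_m|x\rangle}{\sqrt{\alpha}}|x\rangle\langle x|$ and ${\cal K}_m(\rho)=K_m\rho K_m^\dagger$. With ${\cal U}_{t_i\to t_j}(\rho)=U_{t_i\to t_j}\rho U_{t_i\to t_j}^\dagger$, the distribution of observed trajectories (sequential measurement outcomes $m_1,\dots,m_N$ at times $t_1,\dots,t_N$) is $$p^{\cal K}(m_1,\dots,m_N)=\mathrm{Tr}\big[({\cal K}_{m_N}\circ{\cal U}_{t_{N-1}\to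 t_N}\circ\cdots\circ{\cal U}_{t_1\to t_2}\circ{\cal K}_{m_1})(\rho_{t_1})\big].$$ *)

theory Defs
  imports "HOL-Analysis.Analysis"
begin

type_synonym 'n cmat = "complex ^ 'n ^ 'n"

text \<open>
  The dimension of the Hilbert space is \<open>d = CARD('n)\<close>, so \<open>d \<ge> 1\<close> is automatic.
  The inner product of \<open>HOL-Analysis\<close> on \<open>complex ^ 'n\<close> is the real one; the sesquilinear
  product used here is antilinear in the first argument.
\<close>

definition braket :: "complex ^ 'n::finite \<Rightarrow> complex ^ 'n \<Rightarrow> complex" where
  "braket v w = (\<Sum>i\<in>UNIV. cnj (v $ i) * w $ i)"

definition ketbra :: "complex ^ 'n::finite \<Rightarrow> complex ^ 'n \<Rightarrow> 'n cmat" where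
  "ketbra v w = (\<chi> i j. v $ i * cnj (w $ j))"

definition dagger :: "'n::finite cmat \<Rightarrow> 'n cmat" where
  "dagger M = map_matrix cnj (transpose M)"

definition cscale :: "complex \<Rightarrow> 'n::finite cmat \<Rightarrow> 'n cmat" where
  "cscale c M = map_matrix ((*) c) M"

interpretation cmat: vector_space "cscale :: complex \<Rightarrow> 'n::finite cmat \<Rightarrow> 'n cmat"
  by unfold_locales (simp_all add: cscale_def map_matrix_def vec_eq_iff algebra_simps)

definition unitary_mat :: "'n::finite cmat \<Rightarrow> bool" where
  "unitary_mat V \<longleftrightarrow> dagger V ** V = mat 1 \<and> V ** dagger V = mat 1"

definition density_matrix :: "'n::finite cmat \<Rightarrow> bool" where
  "density_matrix \<rho> \<longleftrightarrow>
     dagger \<rho> = \<rho> \<and> (\<forall>v. 0 \<le> Re (braket v (\<rho> *v v))) \<and> trace \<rho> = 1"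

text \<open>As \<open>'n\<close> also indexes the family, an orthonormal family is a basis.\<close>

definition orthonormal_basis :: "('n \<Rightarrow> complex ^ 'n::finite) \<Rightarrow> bool" where
  "orthonormal_basis b \<longleftrightarrow> (\<forall>x y. braket (b x) (b y) = (if x = y then 1 else 0))"

definition observable :: "('n \<Rightarrow> complex ^ 'n::finite) \<Rightarrow> ('n \<Rightarrow> real) \<Rightarrow> 'n cmat" where
  "observable b a = (\<Sum>x\<in>UNIV. cscale (of_real (a x)) (ketbra (b x) (b x)))"

text \<open>\<open>U s s'\<close> is the propagator from time \<open>s\<close> to time \<open>s'\<close>;
  only its values at the times \<open>t 0, \<dots>, t N\<close> matter.\<close>

definition unitary_dynamics ::
    "nat \<Rightarrow> (nat \<Rightarrow> real) \<Rightarrow> (real \<Rightarrow> real \<Rightarrow> 'n::finite cmat) \<Rightarrow> bool" where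
  "unitary_dynamics N t U \<longleftrightarrow>
     (\<forall>i j. i \<le> j \<and> j \<le> N \<longrightarrow> unitary_mat (U (t i) (t j))) \<and>
     (\<forall>i\<le>N. U (t i) (t i) = mat 1) \<and>
     (\<forall>i j l. i \<le> j \<and> j \<le> l \<and> l \<le> N \<longrightarrow>
        U (t i) (t l) = U (t j) (t l) ** U (t i) (t j))"

definition heisenberg ::
    "(real \<Rightarrow> real \<Rightarrow> 'n::finite cmat) \<Rightarrow> real \<Rightarrow> 'n cmat \<Rightarrow> real \<Rightarrow> 'n cmat" where
  "heisenberg U t0 A s = dagger (U t0 s) ** A ** U t0 s"

definition correlation ::
    "(real \<Rightarrow> real \<Rightarrow> 'n::finite cmat) \<Rightarrow> real \<Rightarrow> 'n cmat \<Rightarrow> 'n cmat \<Rightarrow> real list \<Rightarrow> complex"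
  where
  "correlation U t0 \<rho> A ss = trace (\<rho> ** foldr (\<lambda>s M. heisenberg U t0 A s ** M) ss (mat 1))"

definition conj_map :: "'n::finite cmat \<Rightarrow> 'n cmat \<Rightarrow> 'n cmat" where
  "conj_map V \<rho> = V ** \<rho> ** dagger V"

definition kraus ::
    "('n \<Rightarrow> complex ^ 'n::finite) \<Rightarrow> real \<Rightarrow> ('m \<Rightarrow> complex ^ 'n) \<Rightarrow> 'm \<Rightarrow> 'n cmat" where
  "kraus b \<alpha> \<phi> m =
     (\<Sum>x\<in>UNIV. cscale (braket (\<phi> m) (b x) / of_real (sqrt \<alpha>)) (ketbra (b x) (b x)))"

definition informationally_complete :: "('m \<Rightarrow> complex ^ 'n::finite) \<Rightarrow> bool" where
  "informationally_complete \<phi> \<longleftrightarrow> cmat.span (range (\<lambda>m. ketbra (\<phi> m) (\<phi> m))) = UNIV"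

text \<open>
  Unnormalised state at \<open>t n\<close> after the outcomes \<open>m 1, \<dots>, m n\<close>, starting from the state
  \<open>\<rho>\<close> at \<open>t 0\<close>. The first step turns \<open>\<rho>\<close> into the state at \<open>t 1\<close> and measures there;
  there is no measurement at \<open>t 0\<close>.
\<close>

primrec post_state ::
    "('m \<Rightarrow> 'n::finite cmat) \<Rightarrow> (real \<Rightarrow> real \<Rightarrow> 'n cmat) \<Rightarrow> (nat \<Rightarrow> real) \<Rightarrow> 'n cmat \<Rightarrow>
     (nat \<Rightarrow> 'm) \<Rightarrow> nat \<Rightarrow> 'n cmat" where
  "post_state K U t \<rho> m 0 = \<rho>"
| "post_state K U t \<rho> m (Suc n) =
     conj_map (K (m (Suc n))) (conj_map (U (t n) (t (Suc n))) (post_state K U t \<rho> m n))"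

text \<open>
  A trajectory is given as a function \<open>m\<close> on the naturals of which only the values
  \<open>m 1, \<dots>, m N\<close> enter, so that \<open>traj_dist N K U t \<rho>\<close> carries exactly the
  information of the joint distribution of the \<open>N\<close> outcomes.
\<close>

definition traj_dist ::
    "nat \<Rightarrow> ('m \<Rightarrow> 'n::finite cmat) \<Rightarrow> (real \<Rightarrow> real \<Rightarrow> 'n cmat) \<Rightarrow> (nat \<Rightarrow> real) \<Rightarrow> 'n cmat \<Rightarrow>
     (nat \<Rightarrow> 'm) \<Rightarrow> complex" where
  "traj_dist N K U t \<rho> m = trace (post_state K U t \<rho> m N)"

text \<open>
  Nonempty sequences that increase weakly up to some position and decrease weakly from it on;
  the position \<open>j\<close> counts from 0.
\<close>

definition up_down :: "nat list \<Rightarrow> bool" where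
  "up_down \<mu>s \<longleftrightarrow>
     (\<exists>j<length \<mu>s. sorted (take (Suc j) \<mu>s) \<and> sorted_wrt (\<ge>) (drop j \<mu>s))"

end

theory Submission
  imports Defs
begin

text \<open>
  Informational completeness allows weights \<open>c m\<close> with
  \<open>\<Sum>m. c m K\<^sub>m \<sigma> K\<^sub>m\<^sup>\<dagger> = L \<sigma> R\<close> for all \<open>\<sigma>\<close>, whenever \<open>L\<close> and \<open>R\<close> are diagonal in
  the eigenbasis of the observable. Taking \<open>L = A\<^sup>p\<close> and \<open>R = A\<^sup>q\<close> at each time, with \<open>p\<close> and
  \<open>q\<close> the multiplicities of that time in the decreasing and in the increasing part of the
  sequence, the corresponding product-weighted sum of \<open>p\<^sup>K\<close> is
  \<open>Tr[A(t\<^sub>N)\<^sup>p \<cdots> A(t\<^sub>1)\<^sup>p \<rho> A(t\<^sub>1)\<^sup>q \<cdots> A(t\<^sub>N)\<^sup>q]\<close>, which is the correlation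
  function by cyclicity of the trace.
\<close>

subsection \<open>Matrix algebra\<close>

lemma sum_matrix_mult_left:
  fixes M :: "'n::finite cmat"
  shows "M ** sum f S = (\<Sum>i\<in>S. M ** f i)"
  by (induction S rule: infinite_finite_induct) (simp_all add: matrix_add_ldistrib)

lemma sum_matrix_mult_right:
  fixes M :: "'n::finite cmat"
  shows "sum f S ** M = (\<Sum>i\<in>S. f i ** M)"
  by (induction S rule: infinite_finite_induct) (simp_all add: matrix_matrix_mult_def vec_eq_iff distrib_right sum.distrib)

lemma cscale_mult_left: "cscale c A ** B = cscale c (A ** B)"
  by (simp add: cscale_def map_matrix_def matrix_matrix_mult_def vec_eq_iff sum_distrib_left
      mult.assoc)

lemma cscale_mult_right: "A ** cscale c B = cscale c (A ** B)"
  by (simp add: cscale_def map_matrix_def matrix_matrix_mult_def vec_eq_iff sum_distrib_left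
      mult.left_commute)

lemma trace_cscale: "trace (cscale c M) = c * trace M"
  by (simp add: trace_def cscale_def map_matrix_def sum_distrib_left)

lemma trace_sum: "trace (sum f S) = (\<Sum>i\<in>S. trace (f i :: 'n::finite cmat))"
  by (induction S rule: infinite_finite_induct) (simp_all add: trace_def sum.distrib)

lemma dagger_mult: "dagger (A ** B) = dagger B ** dagger A"
  by (simp add: dagger_def map_matrix_def transpose_def matrix_matrix_mult_def vec_eq_iff
      mult.commute)

lemma dagger_sum: "dagger (sum f S) = (\<Sum>i\<in>S. dagger (f i))"
  by (simp add: dagger_def map_matrix_def transpose_def vec_eq_iff)

lemma dagger_cscale: "dagger (cscale c A) = cscale (cnj c) (dagger A)"
  by (simp add: dagger_def cscale_def map_matrix_def transpose_def vec_eq_iff)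

lemma dagger_ketbra: "dagger (ketbra v w) = ketbra w v"
  by (simp add: dagger_def ketbra_def map_matrix_def transpose_def vec_eq_iff mult.commute)

lemma dagger_mat_1: "dagger (mat 1) = mat 1"
  by (auto simp: dagger_def map_matrix_def transpose_def vec_eq_iff mat_def)

lemma ketbra_mult_ketbra: "ketbra u v ** ketbra w z = cscale (braket v w) (ketbra u z)"
  by (simp add: ketbra_def cscale_def map_matrix_def braket_def matrix_matrix_mult_def vec_eq_iff
      sum_distrib_left sum_distrib_right mult_ac)

lemma conj_map_sum: "conj_map V (sum f S) = (\<Sum>i\<in>S. conj_map V (f i))"
  by (simp add: conj_map_def sum_matrix_mult_left sum_matrix_mult_right)

lemma conj_map_cscale: "conj_map V (cscale c M) = cscale c (conj_map V M)"
  by (simp add: conj_map_def cscale_mult_left cscale_mult_right)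

lemma conj_map_mult: "conj_map (V ** W) M = conj_map V (conj_map W M)"
  by (simp add: conj_map_def dagger_mult matrix_mul_assoc)

text \<open>A time index that occurs \<open>k\<close> times in one of the two parts of the sequence
  contributes a \<open>k\<close>-th power with respect to \<open>**\<close>.\<close>

definition mpow :: "'n::finite cmat \<Rightarrow> nat \<Rightarrow> 'n cmat" where
  "mpow A k = (((**) A) ^^ k) (mat 1)"

lemma mpow_0 [simp]: "mpow A 0 = mat 1"
  by (simp add: mpow_def)

lemma mpow_Suc [simp]: "mpow A (Suc k) = A ** mpow A k"
  by (simp add: mpow_def)

text \<open>Neighbouring factors \<open>V ** dagger V\<close> cancel, so powers commute with passing
  to the Heisenberg picture.\<close>

lemma mpow_conj:
  assumes "unitary_mat V"
  shows "mpow (dagger V ** A ** V) k = dagger V ** mpow A k ** V"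
proof (induction k)
  case 0
  then show ?case using assms by (simp add: unitary_mat_def)
next
  case (Suc k)
  have "mpow (dagger V ** A ** V) (Suc k) = dagger V ** A ** (V ** dagger V) ** mpow A k ** V"
    by (simp add: Suc matrix_mul_assoc)
  also have "\<dots> = dagger V ** mpow A (Suc k) ** V"
    using assms by (simp add: unitary_mat_def matrix_mul_assoc)
  finally show ?case .
qed

subsection \<open>Operators diagonal in an orthonormal basis\<close>

text \<open>A common form for the observable, its powers and the Kraus operators; the last need
  complex coefficients.\<close>

definition spectral_op :: "('n::finite \<Rightarrow> complex ^ 'n) \<Rightarrow> ('n \<Rightarrow> complex) \<Rightarrow> 'n cmat" where
  "spectral_op b l = (\<Sum>x\<in>UNIV. cscale (l x) (ketbra (b x) (b x)))"

lemma dagger_spectral_op: "dagger (spectral_op b l) = spectral_op b (\<lambda>x. cnj (l x))"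
  by (simp add: spectral_op_def dagger_sum dagger_cscale dagger_ketbra)

lemma spectral_op_sandwich:
  "spectral_op b l ** M ** spectral_op b r =
    (\<Sum>x\<in>UNIV. \<Sum>y\<in>UNIV. cscale (l x * r y) (ketbra (b x) (b x) ** M ** ketbra (b y) (b y)))"
  by (simp add: spectral_op_def sum_matrix_mult_left sum_matrix_mult_right
      cscale_mult_left cscale_mult_right cmat.scale_sum_right mult.commute) (rule sum.swap)

lemma spectral_op_mult:
  assumes "orthonormal_basis b"
  shows "spectral_op b l ** spectral_op b r = spectral_op b (\<lambda>x. l x * r x)"
proof -
  have "spectral_op b l ** spectral_op b r =
    (\<Sum>x\<in>UNIV. \<Sum>y\<in>UNIV. cscale (l x * r y) (ketbra (b x) (b x) ** ketbra (b y) (b y)))"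
    using spectral_op_sandwich[of b l "mat 1" r] by simp
  also have "\<dots> = (\<Sum>x\<in>UNIV. \<Sum>y\<in>UNIV.
      if y = x then cscale (l x * r x) (ketbra (b x) (b x)) else 0)"
    using assms by (intro sum.cong) (auto simp: ketbra_mult_ketbra orthonormal_basis_def)
  finally show ?thesis
    by (simp add: spectral_op_def)
qed

text \<open>With the basis vectors as columns of a square matrix \<open>B\<close>, orthonormality
  makes \<open>dagger B\<close> a left inverse, hence a right inverse, and
  \<open>B ** dagger B\<close> is the sum of the projectors.\<close>

lemma spectral_op_1:
  assumes "orthonormal_basis b"
  shows "spectral_op b (\<lambda>x. 1) = mat 1"
proof -
  define B :: "'a cmat" where "B = (\<chi> i j. b j $ i)"
  have "dagger B ** B = mat 1"
    using assms by (simp add: B_def dagger_def map_matrix_def transpose_def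
        matrix_matrix_mult_def vec_eq_iff mat_def orthonormal_basis_def braket_def)
  then have "B ** dagger B = mat 1"
    by (simp add: matrix_left_right_inverse)
  moreover have "B ** dagger B = spectral_op b (\<lambda>x. 1)"
    by (simp add: B_def dagger_def map_matrix_def transpose_def matrix_matrix_mult_def
        vec_eq_iff spectral_op_def ketbra_def)
  ultimately show ?thesis by simp
qed

lemma mpow_observable:
  assumes "orthonormal_basis b"
  shows "mpow (observable b a) k = spectral_op b (\<lambda>x. of_real (a x) ^ k)"
proof (induction k)
  case 0
  then show ?case using spectral_op_1[OF assms] by simp
next
  case (Suc k)
  have "observable b a = spectral_op b (\<lambda>x. of_real (a x))"
    by (simp add: observable_def spectral_op_def)
  with Suc show ?case using spectral_op_mult[OF assms] by simp
qed

subsection \<open>Inverting the measurement\<close>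

lemma informationally_complete_coefficients:
  fixes \<phi> :: "'m::finite \<Rightarrow> complex ^ 'n::finite"
  assumes "informationally_complete \<phi>"
  obtains c where "X = (\<Sum>m\<in>UNIV. cscale (c m) (ketbra (\<phi> m) (\<phi> m)))"
proof -
  have "X \<in> cmat.span (range (\<lambda>m. ketbra (\<phi> m) (\<phi> m)))"
    using assms by (simp add: informationally_complete_def)
  then have "\<exists>c. X = (\<Sum>m\<in>UNIV. cscale (c m) (ketbra (\<phi> m) (\<phi> m)))"
  proof (induction rule: cmat.span_induct_alt)
    case base
    show ?case by (intro exI[of _ "\<lambda>_. 0"]) simp
  next
    case (step k Y Z)
    then obtain n c where Y: "Y = ketbra (\<phi> n) (\<phi> n)"
      and Z: "Z = (\<Sum>m\<in>UNIV. cscale (c m) (ketbra (\<phi> m) (\<phi> m)))" by auto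
    \<comment> \<open>The coefficients are indexed by outcomes, and several outcomes may share a
      projector; the new scalar \<open>k\<close> is credited to one chosen outcome
      \<open>n\<close>.\<close>
    have "cscale (if m = n then k else 0) (ketbra (\<phi> m) (\<phi> m)) = (if m = n then cscale k Y else 0)"
      for m by (simp add: Y)
    then show ?case
      by (intro exI[of _ "\<lambda>m. (if m = n then k else 0) + c m"])
        (simp add: Z cmat.scale_left_distrib sum.distrib)
  qed
  then show ?thesis using that by blast
qed

text \<open>The index type is left general: the formula serves both for pairs of basis labels and
  for outcomes.\<close>

lemma braket_ketbra_sum:
  "braket u ((\<Sum>i\<in>S. cscale (c i) (ketbra (f i) (g i))) *v v)
    = (\<Sum>i\<in>S. c i * braket u (f i) * braket (g i) v)"
proof (induction S rule: infinite_finite_induct)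
  case (insert i S)
  have "braket u (cscale k (ketbra w z) *v v) = k * braket u w * braket z v" for k w z
    by (simp add: braket_def cscale_def map_matrix_def ketbra_def matrix_vector_mult_def
        sum_distrib_left sum_distrib_right mult_ac)
  moreover have "braket u (w + z) = braket u w + braket u z" for w z
    by (simp add: braket_def algebra_simps sum.distrib)
  ultimately show ?case
    using insert by (simp add: matrix_vector_mult_add_rdistrib)
qed (simp_all add: braket_def)

lemma braket_commute: "braket v w = cnj (braket w v)"
  by (simp add: braket_def mult.commute)

text \<open>Sandwiching by a Kraus operator multiplies the block of \<open>M\<close> between the
  projectors onto \<open>b x\<close> and \<open>b y\<close> by a matrix element of the projector
  onto \<open>\<phi> m\<close>, up to \<open>\<alpha>\<close>. These projectors span all operators,
  so any array of block factors, in particular \<open>l x * r y\<close>, is a combination of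
  theirs.\<close>

lemma kraus_invert:
  fixes \<phi> :: "'m::finite \<Rightarrow> complex ^ 'n::finite"
  assumes b: "orthonormal_basis b" and \<alpha>: "\<alpha> > 0" and ic: "informationally_complete \<phi>"
  obtains c where "\<And>M. (\<Sum>m\<in>UNIV. cscale (c m) (conj_map (kraus b \<alpha> \<phi> m) M))
      = spectral_op b l ** M ** spectral_op b r"
proof -
  \<comment> \<open>The matrix element of \<open>X\<close> between \<open>b y\<close> and
    \<open>b x\<close> is the wanted factor times \<open>\<alpha>\<close>, which offsets the two
    factors \<open>1 / sqrt \<alpha>\<close> from the Kraus operators.\<close>
  define X where "X = (\<Sum>(x,y)\<in>UNIV. cscale (of_real \<alpha> * l x * r y) (ketbra (b y) (b x)))"
  obtain c where c: "X = (\<Sum>m\<in>UNIV. cscale (c m) (ketbra (\<phi> m) (\<phi> m)))"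
    using informationally_complete_coefficients[OF ic] by blast
  define k where "k m x = braket (\<phi> m) (b x) / of_real (sqrt \<alpha>)" for m x
  have kraus: "kraus b \<alpha> \<phi> m = spectral_op b (k m)" for m
    by (simp add: kraus_def spectral_op_def k_def)
  \<comment> \<open>Compare the matrix elements of \<open>X\<close> in its two expansions.\<close>
  have coeff: "(\<Sum>m\<in>UNIV. c m * (k m x * cnj (k m y))) = l x * r y" for x y
  proof -
    have "braket (b y) (X *v b x) = of_real \<alpha> * l x * r y"
    proof -
      have "braket (b y) (X *v b x)
          = (\<Sum>p\<in>UNIV. of_real \<alpha> * l (fst p) * r (snd p)
              * braket (b y) (b (snd p)) * braket (b (fst p)) (b x))"
        unfolding X_def case_prod_unfold by (rule braket_ketbra_sum)
      also have "\<dots> = (\<Sum>p\<in>UNIV. if p = (x, y) then of_real \<alpha> * l x * r y else 0)"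
        using b by (intro sum.cong) (auto simp: orthonormal_basis_def)
      finally show ?thesis by simp
    qed
    moreover have "braket (b y) (X *v b x)
        = (\<Sum>m\<in>UNIV. c m * braket (b y) (\<phi> m) * braket (\<phi> m) (b x))"
      unfolding c by (rule braket_ketbra_sum)
    moreover have "k m x * cnj (k m y) = braket (b y) (\<phi> m) * braket (\<phi> m) (b x) / of_real \<alpha>" for m
    proof -
      have "complex_of_real (sqrt \<alpha>) * complex_of_real (sqrt \<alpha>) = of_real \<alpha>"
        using \<alpha> by (simp flip: of_real_mult)
      then show ?thesis
        by (simp add: k_def braket_commute[of "b y"])
    qed
    ultimately show ?thesis
      using \<alpha> by (simp add: mult.assoc flip: sum_divide_distrib)
  qed
  have "(\<Sum>m\<in>UNIV. cscale (c m) (conj_map (kraus b \<alpha> \<phi> m) M))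
      = spectral_op b l ** M ** spectral_op b r" for M
  proof -
    let ?P = "\<lambda>x y. ketbra (b x) (b x) ** M ** ketbra (b y) (b y)"
    have "(\<Sum>m\<in>UNIV. cscale (c m) (conj_map (kraus b \<alpha> \<phi> m) M))
      = (\<Sum>m\<in>UNIV. \<Sum>x\<in>UNIV. \<Sum>y\<in>UNIV. cscale (c m * (k m x * cnj (k m y))) (?P x y))"
      by (simp add: conj_map_def kraus dagger_spectral_op spectral_op_sandwich cmat.scale_sum_right)
    also have "\<dots> = (\<Sum>x\<in>UNIV. \<Sum>m\<in>UNIV. \<Sum>y\<in>UNIV. cscale (c m * (k m x * cnj (k m y))) (?P x y))"
      by (rule sum.swap)
    also have "\<dots> = (\<Sum>x\<in>UNIV. \<Sum>y\<in>UNIV. \<Sum>m\<in>UNIV. cscale (c m * (k m x * cnj (k m y))) (?P x y))"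
      by (intro sum.cong refl sum.swap)
    also have "\<dots> = (\<Sum>x\<in>UNIV. \<Sum>y\<in>UNIV. cscale (l x * r y) (?P x y))"
      by (simp add: coeff flip: cmat.scale_sum_left)
    finally show ?thesis by (simp add: spectral_op_sandwich)
  qed
  then show ?thesis using that by blast
qed

subsection \<open>Weighted sums over trajectories\<close>

lemma post_state_cong:
  "(\<And>i. i \<in> {1..n} \<Longrightarrow> m i = m' i) \<Longrightarrow> post_state K U t \<rho> m n = post_state K U t \<rho> m' n"
  by (induction n) auto

text \<open>The recursion of \<open>post_state\<close> with an arbitrary map \<open>\<Phi> i\<close>
  in place of the measurement at step \<open>i\<close>; it need not be a physical operation.\<close>

primrec process_state ::
    "(nat \<Rightarrow> 'n::finite cmat \<Rightarrow> 'n cmat) \<Rightarrow> (real \<Rightarrow> real \<Rightarrow> 'n cmat) \<Rightarrow> (nat \<Rightarrow> real) \<Rightarrow>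
      'n cmat \<Rightarrow> nat \<Rightarrow> 'n cmat" where
  "process_state \<Phi> U t \<rho> 0 = \<rho>"
| "process_state \<Phi> U t \<rho> (Suc n) =
     \<Phi> (Suc n) (conj_map (U (t n) (t (Suc n))) (process_state \<Phi> U t \<rho> n))"

text \<open>Every step is linear and the weights factorise over the steps, so the outcomes can be
  summed out one step at a time.\<close>

lemma weighted_post_state:
  fixes c :: "nat \<Rightarrow> 'm::finite \<Rightarrow> complex"
  assumes \<Phi>: "\<And>i M. (\<Sum>m\<in>UNIV. cscale (c i m) (conj_map (K m) M)) = \<Phi> i M"
  shows "(\<Sum>m\<in>PiE {1..n} (\<lambda>_. UNIV). cscale (\<Prod>i\<in>{1..n}. c i (m i)) (post_state K U t \<rho> m n))
    = process_state \<Phi> U t \<rho> n"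
proof (induction n)
  case 0
  then show ?case by simp
next
  case (Suc n)
  let ?E = "PiE {1..n} (\<lambda>_. UNIV) :: (nat \<Rightarrow> 'm) set"
  let ?V = "conj_map (U (t n) (t (Suc n)))"
  let ?w = "\<lambda>g. \<Prod>i\<in>{1..n}. c i (g i)"
  \<comment> \<open>A trajectory of \<open>n + 1\<close> outcomes is one of \<open>n\<close>
    outcomes extended by its last outcome \<open>y\<close>.\<close>
  have PiE: "PiE {1..Suc n} (\<lambda>_. UNIV) = (\<lambda>(y, g). g(Suc n := y)) ` (UNIV \<times> ?E)"
    by (simp add: atLeastAtMostSuc_conv PiE_insert_eq)
  have inj: "inj_on (\<lambda>(y, g). g(Suc n := y)) (UNIV \<times> ?E)"
    using inj_combinator[of "Suc n" "{1..n}" "\<lambda>_. UNIV :: 'm set"] by simp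
  have weight: "(\<Prod>i\<in>{1..Suc n}. c i ((g(Suc n := y)) i)) = c (Suc n) y * ?w g" for g y
    by (simp add: atLeastAtMostSuc_conv)
  have state: "post_state K U t \<rho> (g(Suc n := y)) n = post_state K U t \<rho> g n" for g y
    by (rule post_state_cong) simp
  have "(\<Sum>m\<in>PiE {1..Suc n} (\<lambda>_. UNIV).
        cscale (\<Prod>i\<in>{1..Suc n}. c i (m i)) (post_state K U t \<rho> m (Suc n)))
      = (\<Sum>(y, g)\<in>UNIV \<times> ?E. cscale (c (Suc n) y * ?w g) (conj_map (K y) (?V (post_state K U t \<rho> g n))))"
    by (rule sum.reindex_cong[OF inj PiE])
      (simp only: case_prod_unfold weight state post_state.simps fun_upd_same)
  also have "\<dots> = (\<Sum>y\<in>UNIV. cscale (c (Suc n) y)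
      (conj_map (K y) (?V (\<Sum>g\<in>?E. cscale (?w g) (post_state K U t \<rho> g n)))))"
    by (simp add: conj_map_sum conj_map_cscale cmat.scale_sum_right
        flip: sum.cartesian_product)
  also have "\<dots> = process_state \<Phi> U t \<rho> (Suc n)"
    by (simp only: Suc \<Phi> process_state.simps)
  finally show ?case .
qed

subsection \<open>Ordered operator products\<close>

text \<open>The fold of \<open>correlation\<close>, but over indices instead of times, since
  distinct indices may carry equal times.\<close>

definition op_product :: "('i \<Rightarrow> 'n::finite cmat) \<Rightarrow> 'i list \<Rightarrow> 'n cmat" where
  "op_product H is = foldr (\<lambda>i M. H i ** M) is (mat 1)"

lemma op_product_Nil [simp]: "op_product H [] = mat 1"
  by (simp add: op_product_def)

lemma op_product_Cons [simp]: "op_product H (i # is) = H i ** op_product H is"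
  by (simp add: op_product_def)

lemma op_product_append: "op_product H (is @ js) = op_product H is ** op_product H js"
  by (induction "is") (simp_all add: matrix_mul_assoc)

lemma op_product_filter_eq: "op_product H (filter (\<lambda>i. i = k) is) = mpow (H k) (count_list is k)"
  by (induction "is") auto

text \<open>Step \<open>n + 1\<close> thus adds its factors at the right end of the increasing
  product; in the decreasing one they appear at the left end. These are the outer sides when the
  state stands between the two products.\<close>

lemma filter_le_Suc_sorted:
  fixes "is" :: "nat list"
  shows "sorted is \<Longrightarrow> filter (\<lambda>i. i \<le> Suc n) is = filter (\<lambda>i. i \<le> n) is @ filter (\<lambda>i. i = Suc n) is"
proof (induction "is")
  case (Cons i "is")
  show ?case
  proof (cases "i \<le> n")
    case False
    then have "filter (\<lambda>i. i \<le> n) is = []"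
      using Cons.prems by (auto simp: filter_empty_conv)
    then show ?thesis using Cons False by auto
  qed (use Cons in auto)
qed simp

lemma filter_le_Suc_sorted_desc:
  fixes "is" :: "nat list"
  assumes "sorted_wrt (\<ge>) is"
  shows "filter (\<lambda>i. i \<le> Suc n) is = filter (\<lambda>i. i = Suc n) is @ filter (\<lambda>i. i \<le> n) is"
proof -
  have "sorted (rev is)"
    using assms by (simp add: sorted_wrt_rev)
  from filter_le_Suc_sorted[OF this, of n] show ?thesis
    by (simp flip: rev_filter rev_append)
qed

text \<open>Induction on the step: pulled back to \<open>t 0\<close>, the state is
  \<open>\<rho>\<close> between the Heisenberg operators of the indices reached so far, and each
  step puts its own powers on the outside.\<close>

lemma process_state_heisenberg:
  fixes U :: "real \<Rightarrow> real \<Rightarrow> 'n::finite cmat" and A :: "'n cmat"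
  assumes U: "unitary_dynamics N t U" and "n \<le> N"
    and us: "sorted us" "set us \<subseteq> {1..}" and ds: "sorted_wrt (\<ge>) ds" "set ds \<subseteq> {1..}"
  defines "H \<equiv> \<lambda>i. heisenberg U (t 0) A (t i)"
  shows "process_state (\<lambda>i M. mpow A (count_list ds i) ** M ** mpow A (count_list us i)) U t \<rho> n
    = conj_map (U (t 0) (t n))
        (op_product H (filter (\<lambda>i. i \<le> n) ds) ** \<rho> ** op_product H (filter (\<lambda>i. i \<le> n) us))"
  using \<open>n \<le> N\<close>
proof (induction n)
  case 0
  \<comment> \<open>Indices start at 1, so nothing acts at \<open>t 0\<close>.\<close>
  have "filter (\<lambda>i. i \<le> 0) us = []" "filter (\<lambda>i. i \<le> 0) ds = []"
    using us ds by (auto simp: filter_empty_conv)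
  then show ?case
    using U by (simp add: unitary_dynamics_def conj_map_def dagger_mat_1)
next
  case (Suc n)
  define V where "V = U (t 0) (t (Suc n))"
  define p q where "p = count_list ds (Suc n)" and "q = count_list us (Suc n)"
  define D Q where "D = op_product H (filter (\<lambda>i. i \<le> n) ds)"
    and "Q = op_product H (filter (\<lambda>i. i \<le> n) us)"
  have V: "unitary_mat V" "U (t n) (t (Suc n)) ** U (t 0) (t n) = V"
    using U Suc.prems unfolding unitary_dynamics_def V_def by (blast, metis le0 le_Suc_eq order.refl)
  have Hpow: "mpow (H (Suc n)) k = dagger V ** mpow A k ** V" for k
    unfolding H_def heisenberg_def using mpow_conj V(1) by (simp add: V_def)
  \<comment> \<open>The outer \<open>V\<close> and \<open>dagger V\<close> cancel against those of
    the new Heisenberg powers, which exposes the Schroedinger-picture powers around the propagated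
    state.\<close>
  have "conj_map V (op_product H (filter (\<lambda>i. i \<le> Suc n) ds) ** \<rho>
        ** op_product H (filter (\<lambda>i. i \<le> Suc n) us))
      = V ** ((dagger V ** mpow A p ** V) ** D ** \<rho> ** (Q ** (dagger V ** mpow A q ** V))) ** dagger V"
    by (simp add: filter_le_Suc_sorted[OF us(1)] filter_le_Suc_sorted_desc[OF ds(1)]
        op_product_append op_product_filter_eq Hpow D_def Q_def p_def q_def conj_map_def)
  also have "\<dots> = (V ** dagger V) ** mpow A p ** (V ** (D ** \<rho> ** Q) ** dagger V)
      ** mpow A q ** (V ** dagger V)"
    by (simp add: matrix_mul_assoc)
  also have "\<dots> = mpow A p ** conj_map V (D ** \<rho> ** Q) ** mpow A q"
    using V(1) by (simp add: unitary_mat_def conj_map_def)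
  also have "conj_map V (D ** \<rho> ** Q)
      = conj_map (U (t n) (t (Suc n))) (conj_map (U (t 0) (t n)) (D ** \<rho> ** Q))"
    by (simp flip: conj_map_mult add: V(2))
  finally show ?case
    using Suc by (simp add: V_def p_def q_def D_def Q_def)
qed

section \<open>Correlation functions from the trajectory distribution\<close>

lemma trace_conj_map:
  assumes "unitary_mat V"
  shows "trace (conj_map V M) = trace M"
proof -
  have "trace (conj_map V M) = trace (dagger V ** (V ** M))"
    unfolding conj_map_def by (rule trace_mul_sym)
  then show ?thesis
    using assms by (simp add: matrix_mul_assoc unitary_mat_def)
qed

text \<open>The trace removes the final propagation, and cyclicity moves the decreasing product from
  the left of \<open>\<rho>\<close> to behind the increasing one.\<close>

lemma trace_process_state:
  fixes U :: "real \<Rightarrow> real \<Rightarrow> 'n::finite cmat"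
  assumes U: "unitary_dynamics N t U"
    and us: "sorted us" "set us \<subseteq> {1..N}" and ds: "sorted_wrt (\<ge>) ds" "set ds \<subseteq> {1..N}"
  shows "trace (process_state
        (\<lambda>i M. mpow A (count_list ds i) ** M ** mpow A (count_list us i)) U t \<rho> N)
    = correlation U (t 0) \<rho> A (map t (us @ ds))"
proof -
  define H where "H = (\<lambda>i. heisenberg U (t 0) A (t i))"
  have filter: "filter (\<lambda>i. i \<le> N) us = us" "filter (\<lambda>i. i \<le> N) ds = ds"
    using us ds by (auto simp: filter_id_conv)
  have "unitary_mat (U (t 0) (t N))"
    using U by (simp add: unitary_dynamics_def)
  moreover have "set us \<subseteq> {1..}" "set ds \<subseteq> {1..}"
    using us ds by auto
  ultimately have "trace (process_state
        (\<lambda>i M. mpow A (count_list ds i) ** M ** mpow A (count_list us i)) U t \<rho> N)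
      = trace (op_product H ds ** (\<rho> ** op_product H us))"
    using process_state_heisenberg[OF U order.refl us(1) _ ds(1), of A \<rho>]
    by (simp add: filter H_def trace_conj_map matrix_mul_assoc)
  also have "\<dots> = trace (\<rho> ** op_product H us ** op_product H ds)"
    by (rule trace_mul_sym)
  also have "\<dots> = trace (\<rho> ** op_product H (us @ ds))"
    by (simp add: op_product_append matrix_mul_assoc)
  also have "\<dots> = correlation U (t 0) \<rho> A (map t (us @ ds))"
    by (simp add: correlation_def op_product_def H_def foldr_map comp_def)
  finally show ?thesis .
qed

text \<open>In \<open>up_down\<close> the peak lies in both parts; here it is kept in
  \<open>us\<close> only, so that its operator is counted once.\<close>

lemma up_down_split:
  assumes "up_down \<mu>s"
  obtains us ds where "\<mu>s = us @ ds" "sorted us" "sorted_wrt (\<ge>) ds"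
proof -
  obtain j where j: "sorted (take (Suc j) \<mu>s)" "sorted_wrt (\<ge>) (drop j \<mu>s)"
    using assms by (auto simp: up_down_def)
  then have "sorted_wrt (\<ge>) (drop (Suc j) \<mu>s)"
    by (metis drop_Suc sorted_wrt_drop tl_drop drop_drop plus_1_eq_Suc)
  with j show ?thesis
    using that[of "take (Suc j) \<mu>s" "drop (Suc j) \<mu>s"] by simp
qed

text \<open>The weights are obtained before \<open>U\<close> and \<open>\<rho>\<close> are fixed:
  this is what makes the correlation function deducible from the distribution alone.\<close>

lemma correlation_from_traj_dist:
  fixes \<phi> :: "'m::finite \<Rightarrow> complex ^ 'n::finite"
  assumes b: "orthonormal_basis b" and \<alpha>: "\<alpha> > 0" and ic: "informationally_complete \<phi>"
    and us: "sorted us" "set us \<subseteq> {1..N}" and ds: "sorted_wrt (\<ge>) ds" "set ds \<subseteq> {1..N}"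
  obtains w where "\<And>U \<rho>. unitary_dynamics N t U \<Longrightarrow>
    correlation U (t 0) \<rho> (observable b a) (map t (us @ ds))
      = (\<Sum>m\<in>PiE {1..N} (\<lambda>_. UNIV). w m * traj_dist N (kraus b \<alpha> \<phi>) U t \<rho> m)"
proof -
  let ?A = "observable b a"
  define \<Phi> where "\<Phi> = (\<lambda>i M. mpow ?A (count_list ds i) ** M ** mpow ?A (count_list us i))"
  \<comment> \<open>For each \<open>i\<close> the measurement is inverted with \<open>l\<close> and
    \<open>r\<close> the powers of the eigenvalues given by the multiplicities of \<open>i\<close>
    in \<open>ds\<close> and \<open>us\<close>.\<close>
  have "\<exists>c. \<forall>M. (\<Sum>m\<in>UNIV. cscale (c m) (conj_map (kraus b \<alpha> \<phi> m) M)) = \<Phi> i M" for i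
    unfolding \<Phi>_def mpow_observable[OF b] by (rule kraus_invert[OF b \<alpha> ic]) blast
  then obtain c where c: "\<And>i M. (\<Sum>m\<in>UNIV. cscale (c i m) (conj_map (kraus b \<alpha> \<phi> m) M)) = \<Phi> i M"
    by metis
  show ?thesis
  proof (rule that)
    fix U :: "real \<Rightarrow> real \<Rightarrow> 'n cmat" and \<rho>
    assume U: "unitary_dynamics N t U"
    have "correlation U (t 0) \<rho> ?A (map t (us @ ds)) = trace (process_state \<Phi> U t \<rho> N)"
      unfolding \<Phi>_def by (rule trace_process_state[OF U us ds, symmetric])
    also have "\<dots> = (\<Sum>m\<in>PiE {1..N} (\<lambda>_. UNIV).
        (\<Prod>i\<in>{1..N}. c i (m i)) * traj_dist N (kraus b \<alpha> \<phi>) U t \<rho> m)"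
      by (simp only: weighted_post_state[OF c, symmetric] trace_sum trace_cscale traj_dist_def)
    finally show "correlation U (t 0) \<rho> ?A (map t (us @ ds)) = \<dots>" .
  qed
qed

text \<open>A single \<open>F\<close>, fixed before \<open>U\<close>, \<open>\<rho>\<close> and
  \<open>\<mu>s\<close>, expresses simultaneous deducibility.\<close>

theorem mainTheorem4:
  fixes N :: nat
    and b :: "'n::finite \<Rightarrow> complex ^ 'n"
    and a :: "'n \<Rightarrow> real"
    and A :: "'n cmat"
    and t :: "nat \<Rightarrow> real"
    and \<phi> :: "'m::finite \<Rightarrow> complex ^ 'n"
    and \<alpha> :: real
  assumes "N \<ge> 1"
    and "orthonormal_basis b"
    and "A = observable b a"
    and "\<And>i j. i \<le> j \<Longrightarrow> j \<le> N \<Longrightarrow> t i \<le> t j"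
    and "\<And>m. braket (\<phi> m) (\<phi> m) = 1"
    and "\<alpha> > 0"
    and "(\<Sum>m\<in>UNIV. ketbra (\<phi> m) (\<phi> m)) = cscale (of_real \<alpha>) (mat 1)"
    and "informationally_complete \<phi>"
  shows "\<exists>F :: ((nat \<Rightarrow> 'm) \<Rightarrow> complex) \<Rightarrow> nat list \<Rightarrow> complex.
           \<forall>U \<rho>. unitary_dynamics N t U \<and> density_matrix \<rho> \<longrightarrow>
             (\<forall>\<mu>s. set \<mu>s \<subseteq> {1..N} \<and> up_down \<mu>s \<longrightarrow>
                correlation U (t 0) \<rho> A (map t \<mu>s) =
                  F (traj_dist N (kraus b \<alpha> \<phi>) U t \<rho>) \<mu>s)"
proof -
  have "\<exists>w. \<forall>U \<rho>. unitary_dynamics N t U \<longrightarrow> correlation U (t 0) \<rho> A (map t \<mu>s)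
      = (\<Sum>m\<in>PiE {1..N} (\<lambda>_. UNIV). w m * traj_dist N (kraus b \<alpha> \<phi>) U t \<rho> m)"
    if \<mu>s: "set \<mu>s \<subseteq> {1..N}" "up_down \<mu>s" for \<mu>s
  proof -
    obtain us ds where split: "\<mu>s = us @ ds" "sorted us" "sorted_wrt (\<ge>) ds"
      using up_down_split \<mu>s(2) by blast
    then have "set us \<subseteq> {1..N}" "set ds \<subseteq> {1..N}"
      using \<mu>s(1) by auto
    then show ?thesis
      using correlation_from_traj_dist[OF assms(2,6,8) split(2) _ split(3), of N t a]
      unfolding split(1) assms(3) by metis
  qed
  then obtain w where "\<And>\<mu>s U \<rho>. set \<mu>s \<subseteq> {1..N} \<Longrightarrow> up_down \<mu>s \<Longrightarrow> unitary_dynamics N t U \<Longrightarrow>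
      correlation U (t 0) \<rho> A (map t \<mu>s)
      = (\<Sum>m\<in>PiE {1..N} (\<lambda>_. UNIV). w \<mu>s m * traj_dist N (kraus b \<alpha> \<phi>) U t \<rho> m)"
    by metis
  then show ?thesis
    \<comment> \<open>\<open>F\<close> is linear in the distribution, with weights chosen separately
      for each \<open>\<mu>s\<close>.\<close>
    by (intro exI[of _ "\<lambda>f \<mu>s. \<Sum>m\<in>PiE {1..N} (\<lambda>_. UNIV). w \<mu>s m * f m"]) blast
qed

end
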